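(* Let $V$ be a countable set with at least two elements. Let $(K_t)_{t\ge1}$ be a sequence of aperiodic and irreducible Markov transition operators on $V$ and $(\pi_t)_{t\ge1}$ a sequence of positive measures such that $\{(K_t,\pi_t)\}_{t\ge1}$ is a finite non-decreasing environment. Let $\alpha_t=\alpha(K_t^*K_t,\tilde\pi_t)$ be the logarithmic Sobolev constant of $K_t^*K_t$, where $K_t^*$ is the adjoint of $K_t$ on $\ell^2(\tilde\pi_t)$. For $q\ge2$ and $t\ge1$ define $$q_t=q\prod_{s=1}^t(1+\alpha_s).$$ Then for all $q\ge2$ and all $t\ge1$, $$\forall p\in[1,q_t],\ \forall f\in\ell^q(\pi_t),\quad \left\|K_{0,t}f\right\|_{\ell^p(\tilde\pi_1)}\le\left\|f\right\|_{\ell^q(\tilde\pi_t)}\left(\frac{\pi_t(V)}{\pi_1(V)}\right)^{1/q}.$$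
   Context: A Markov transition operator $K$ on $V$ is a map $K:V\times V\to[0,1]$ with $\sum_y K(x,y)=1$ for all $x$; it acts on functions by $(Kf)(x)=\sum_y K(x,y)f(y)$ and on measures by $(\mu K)(y)=\sum_x\mu(x)K(x,y)$. $K_{0,t}=K_1\cdots K_t$. Finite non-decreasing environment: the $\pi_t$ are positive measures ($\pi_t(x)>0$ for all $x$) with, for all $t\ge1$: $\pi_tK_t=\pi_t$; $\pi_t(V)<+\infty$; $\pi_{t+1}(x)\ge\pi_t(x)$ for all $x\in V$. For a finite measure $\pi$, $\tilde\pi:=\pi/\pi(V)$; $\|f\|_{\ell^p(\tilde\pi)}=(\sum_x|f(x)|^p\tilde\pi(x))^{1/p}$. Dirichlet form: $\mathcal E_{Q,\tilde\pi}(f,f)=\langle(I-Q)f,f\rangle_{\tilde\pi}=\frac12\sum_{x,y}(f(x)-f(y))^2\tilde\pi(x)Q(x,y)$. Entropy of a non-negative $f\in\ell^1(\tilde\pi)$: $\mathcal L(f\mid\tilde\pi)=\sum_xf(x)\log\left(\frac{f(x)}{\tilde\pi(f)}\right)\tilde\pi(x)\in[0,+\infty]$ (with $0\log0=0$). The logarithmic Sobolev constant $\alpha(Q)=\alpha(Q,\tilde\pi)\ge0$ is the largest $\alpha\ge 0$ with $\alpha\,\mathcal L(f^2\mid\tilde\pi)\le\mathcal E_{Q,\tilde\pi}(f,f)$ for all non-constant non-negative $f\in\ell^2(\tilde\pi)$ (with $0\cdot\infty=0$). *)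

theory Defs
  imports "HOL-Analysis.Analysis"
begin

text \<open>
  The state space is a type \<open>'v\<close> of class \<open>countable\<close> (finite or countably infinite). Kernels are
  functions \<open>'v \<Rightarrow> 'v \<Rightarrow> real\<close>, and measures with finite point masses are weight functions
  \<open>'v \<Rightarrow> real\<close>.
\<close>

section \<open>Markov kernels\<close>

definition markov_kernel :: "('v \<Rightarrow> 'v \<Rightarrow> real) \<Rightarrow> bool" where
  "markov_kernel K \<longleftrightarrow> (\<forall>x y. 0 \<le> K x y \<and> K x y \<le> 1) \<and> (\<forall>x. (K x has_sum 1) UNIV)"

definition fun_act :: "('v \<Rightarrow> 'v \<Rightarrow> real) \<Rightarrow> ('v \<Rightarrow> real) \<Rightarrow> 'v \<Rightarrow> real" where
  "fun_act K f x = (\<Sum>\<^sub>\<infinity>y. K x y * f y)"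

definition measure_act :: "('v \<Rightarrow> real) \<Rightarrow> ('v \<Rightarrow> 'v \<Rightarrow> real) \<Rightarrow> 'v \<Rightarrow> real" where
  "measure_act \<mu> K y = (\<Sum>\<^sub>\<infinity>x. \<mu> x * K x y)"

definition kernel_id :: "'v \<Rightarrow> 'v \<Rightarrow> real" where
  "kernel_id x y = (if x = y then 1 else 0)"

definition kernel_comp :: "('v \<Rightarrow> 'v \<Rightarrow> real) \<Rightarrow> ('v \<Rightarrow> 'v \<Rightarrow> real) \<Rightarrow> 'v \<Rightarrow> 'v \<Rightarrow> real" where
  "kernel_comp K L x z = (\<Sum>\<^sub>\<infinity>y. K x y * L y z)"

text \<open>\<open>kernel_prod K t\<close> is $K_{0,t} = K_1 \cdots K_t$; the value \<open>K 0\<close> is never used.\<close>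

primrec kernel_prod :: "(nat \<Rightarrow> 'v \<Rightarrow> 'v \<Rightarrow> real) \<Rightarrow> nat \<Rightarrow> 'v \<Rightarrow> 'v \<Rightarrow> real" where
  "kernel_prod K 0 = kernel_id"
| "kernel_prod K (Suc t) = kernel_comp (kernel_prod K t) (K (Suc t))"

definition kernel_power :: "('v \<Rightarrow> 'v \<Rightarrow> real) \<Rightarrow> nat \<Rightarrow> 'v \<Rightarrow> 'v \<Rightarrow> real" where
  "kernel_power K n = kernel_prod (\<lambda>_. K) n"

definition irreducible_kernel :: "('v \<Rightarrow> 'v \<Rightarrow> real) \<Rightarrow> bool" where
  "irreducible_kernel K \<longleftrightarrow> (\<forall>x y. \<exists>n. kernel_power K n x y > 0)"

definition aperiodic_kernel :: "('v \<Rightarrow> 'v \<Rightarrow> real) \<Rightarrow> bool" where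
  "aperiodic_kernel K \<longleftrightarrow> (\<forall>x. Gcd {n. n \<ge> 1 \<and> kernel_power K n x x > 0} = 1)"


section \<open>Finite measures and environments\<close>

definition mass :: "('v \<Rightarrow> real) \<Rightarrow> real" where
  "mass \<mu> = (\<Sum>\<^sub>\<infinity>x. \<mu> x)"

definition normalized :: "('v \<Rightarrow> real) \<Rightarrow> 'v \<Rightarrow> real" where
  "normalized \<mu> x = \<mu> x / mass \<mu>"

definition finite_nondecreasing_env ::
    "(nat \<Rightarrow> 'v \<Rightarrow> 'v \<Rightarrow> real) \<Rightarrow> (nat \<Rightarrow> 'v \<Rightarrow> real) \<Rightarrow> bool" where
  "finite_nondecreasing_env K \<pi> \<longleftrightarrow>
     (\<forall>t\<ge>1. markov_kernel (K t) \<and> (\<forall>x. \<pi> t x > 0) \<and> measure_act (\<pi> t) (K t) = \<pi> t \<and>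
            \<pi> t summable_on UNIV \<and> (\<forall>x. \<pi> (Suc t) x \<ge> \<pi> t x))"


section \<open>Weighted l-p spaces and adjoints\<close>

definition lp :: "real \<Rightarrow> ('v \<Rightarrow> real) \<Rightarrow> ('v \<Rightarrow> real) set" where
  "lp p \<mu> = {f. (\<lambda>x. \<bar>f x\<bar> powr p * \<mu> x) summable_on UNIV}"

definition lp_norm :: "real \<Rightarrow> ('v \<Rightarrow> real) \<Rightarrow> ('v \<Rightarrow> real) \<Rightarrow> real" where
  "lp_norm p \<mu> f = (\<Sum>\<^sub>\<infinity>x. \<bar>f x\<bar> powr p * \<mu> x) powr (1 / p)"

definition l2_inner :: "('v \<Rightarrow> real) \<Rightarrow> ('v \<Rightarrow> real) \<Rightarrow> ('v \<Rightarrow> real) \<Rightarrow> real" where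
  "l2_inner \<mu> f g = (\<Sum>\<^sub>\<infinity>x. f x * g x * \<mu> x)"

definition is_l2_adjoint ::
    "('v \<Rightarrow> real) \<Rightarrow> ('v \<Rightarrow> 'v \<Rightarrow> real) \<Rightarrow> ('v \<Rightarrow> 'v \<Rightarrow> real) \<Rightarrow> bool" where
  "is_l2_adjoint \<mu> K Q \<longleftrightarrow>
     (\<forall>f\<in>lp 2 \<mu>. \<forall>g\<in>lp 2 \<mu>. l2_inner \<mu> (fun_act K f) g = l2_inner \<mu> f (fun_act Q g))"

text \<open>
  The kernel of the adjoint operator. Existence and uniqueness are shown below: for a positive
  finite measure preserved by the Markov kernel \<open>K\<close> it is $K^*(x,y) = \mu(y) K(y,x) / \mu(x)$.
\<close>

definition l2_adjoint :: "('v \<Rightarrow> real) \<Rightarrow> ('v \<Rightarrow> 'v \<Rightarrow> real) \<Rightarrow> 'v \<Rightarrow> 'v \<Rightarrow> real" where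
  "l2_adjoint \<mu> K = (THE Q. is_l2_adjoint \<mu> K Q)"


section \<open>Dirichlet form, entropy, logarithmic Sobolev constant\<close>

definition dirichlet_form :: "('v \<Rightarrow> 'v \<Rightarrow> real) \<Rightarrow> ('v \<Rightarrow> real) \<Rightarrow> ('v \<Rightarrow> real) \<Rightarrow> real" where
  "dirichlet_form Q \<mu> f = l2_inner \<mu> (\<lambda>x. f x - fun_act Q f x) f"

text \<open>
  For \<open>\<mu>\<close> a probability measure and \<open>f \<ge> 0\<close> integrable with mean \<open>m\<close>, the summand of the entropy
  is at least \<open>(f x - m) * \<mu> x\<close>, so its negative part is summable and the sum exists in
  $(-\infty,+\infty]$: it is infinite exactly when the summand is not summable. The convention
  \<open>0 log 0 = 0\<close> is automatic.
\<close>

definition entropy_term :: "('v \<Rightarrow> real) \<Rightarrow> ('v \<Rightarrow> real) \<Rightarrow> 'v \<Rightarrow> real" where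
  "entropy_term \<mu> f x = f x * ln (f x / (\<Sum>\<^sub>\<infinity>z. f z * \<mu> z)) * \<mu> x"

definition entropy :: "('v \<Rightarrow> real) \<Rightarrow> ('v \<Rightarrow> real) \<Rightarrow> ereal" where
  "entropy \<mu> f =
     (if entropy_term \<mu> f summable_on UNIV then ereal (\<Sum>\<^sub>\<infinity>x. entropy_term \<mu> f x) else \<infinity>)"

text \<open>In \<open>ereal\<close> one has \<open>0 * \<infinity> = 0\<close>, as required here.\<close>

definition log_sobolev_bound :: "('v \<Rightarrow> 'v \<Rightarrow> real) \<Rightarrow> ('v \<Rightarrow> real) \<Rightarrow> real \<Rightarrow> bool" where
  "log_sobolev_bound Q \<mu> a \<longleftrightarrow> a \<ge> 0 \<and>
     (\<forall>f\<in>lp 2 \<mu>. (\<forall>x. f x \<ge> 0) \<and> \<not> f constant_on UNIV \<longrightarrow>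
        ereal a * entropy \<mu> (\<lambda>x. (f x)\<^sup>2) \<le> ereal (dirichlet_form Q \<mu> f))"

definition log_sobolev :: "('v \<Rightarrow> 'v \<Rightarrow> real) \<Rightarrow> ('v \<Rightarrow> real) \<Rightarrow> real" where
  "log_sobolev Q \<mu> = (GREATEST a. log_sobolev_bound Q \<mu> a)"

text \<open>$\alpha_t = \alpha(K_t^* K_t, \tilde\pi_t)$\<close>

definition env_log_sobolev ::
    "(nat \<Rightarrow> 'v \<Rightarrow> 'v \<Rightarrow> real) \<Rightarrow> (nat \<Rightarrow> 'v \<Rightarrow> real) \<Rightarrow> nat \<Rightarrow> real" where
  "env_log_sobolev K \<pi> t =
     log_sobolev (kernel_comp (l2_adjoint (normalized (\<pi> t)) (K t)) (K t)) (normalized (\<pi> t))"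


section \<open>The descriptions by \<open>THE\<close> and \<open>GREATEST\<close> are proper\<close>

lemma lp2_iff: "f \<in> lp 2 \<mu> \<longleftrightarrow> (\<lambda>x. (f x)\<^sup>2 * \<mu> x) summable_on UNIV"
proof -
  have "\<bar>f x\<bar> powr 2 = (f x)\<^sup>2" for x
    by (cases "f x = 0") (auto simp: powr_numeral)
  then show ?thesis by (simp add: lp_def)
qed

lemma pair_summable_fst:
  fixes \<mu> :: "'v \<Rightarrow> real" and K :: "'v \<Rightarrow> 'v \<Rightarrow> real"
  assumes K: "markov_kernel K" and pos: "\<And>x. \<mu> x > 0"
    and g: "(\<lambda>x. g x * \<mu> x) summable_on UNIV" and g0: "\<And>x. g x \<ge> 0"
  shows "((\<lambda>(x,y). \<mu> x * K x y * g x) has_sum (\<Sum>\<^sub>\<infinity>x. g x * \<mu> x)) (UNIV \<times> UNIV)"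
proof -
  have 1: "((\<lambda>y. \<mu> x * K x y * g x) has_sum (g x * \<mu> x)) UNIV" for x
  proof -
    have "(K x has_sum 1) UNIV" using K by (simp add: markov_kernel_def)
    then have "((\<lambda>y. (\<mu> x * g x) * K x y) has_sum (\<mu> x * g x) * 1) UNIV"
      by (rule has_sum_cmult_right)
    then show ?thesis by (simp add: mult_ac)
  qed
  have nn: "0 \<le> \<mu> x * K x y * g x" for x y
    using K pos[of x] g0[of x] by (simp add: markov_kernel_def less_imp_le)
  have "(\<lambda>(x,y). \<mu> x * K x y * g x) summable_on (UNIV \<times> UNIV)"
    using 1 g nn by (intro summable_on_SigmaI[where g = "\<lambda>x. g x * \<mu> x"]) auto
  then show ?thesis
    using 1 g by (intro has_sum_SigmaI[where g = "\<lambda>x. g x * \<mu> x"]) auto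
qed

lemma measure_act_has_sum:
  fixes \<mu> :: "'v \<Rightarrow> real"
  assumes pos: "\<And>x. \<mu> x > 0" and inv: "measure_act \<mu> K = \<mu>"
  shows "((\<lambda>x. \<mu> x * K x y) has_sum \<mu> y) UNIV"
proof -
  have e: "(\<Sum>\<^sub>\<infinity>x. \<mu> x * K x y) = \<mu> y" using inv by (metis measure_act_def)
  then have "(\<lambda>x. \<mu> x * K x y) summable_on UNIV"
    using pos[of y] infsum_not_exists by force
  then show ?thesis using e by (metis has_sum_infsum)
qed

lemma pair_summable_snd:
  fixes \<mu> :: "'v \<Rightarrow> real" and K :: "'v \<Rightarrow> 'v \<Rightarrow> real"
  assumes K: "markov_kernel K" and pos: "\<And>x. \<mu> x > 0" and inv: "measure_act \<mu> K = \<mu>"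
    and g: "(\<lambda>x. g x * \<mu> x) summable_on UNIV" and g0: "\<And>x. g x \<ge> 0"
  shows "((\<lambda>(x,y). \<mu> x * K x y * g y) has_sum (\<Sum>\<^sub>\<infinity>x. g x * \<mu> x)) (UNIV \<times> UNIV)"
proof -
  have 0: "((\<lambda>x. \<mu> x * K x y) has_sum \<mu> y) UNIV" for y
    by (rule measure_act_has_sum[OF pos inv])
  have 1: "((\<lambda>x. \<mu> x * K x y * g y) has_sum (g y * \<mu> y)) UNIV" for y
    using has_sum_cmult_left[OF 0[of y], where c = "g y"] by (simp add: mult_ac)
  have nn: "0 \<le> \<mu> x * K x y * g y" for x y
    using K pos[of x] g0[of y] by (simp add: markov_kernel_def less_imp_le)
  have "(\<lambda>(y,x). \<mu> x * K x y * g y) summable_on (UNIV \<times> UNIV)"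
    using 1 g nn by (intro summable_on_SigmaI[where g = "\<lambda>x. g x * \<mu> x"]) auto
  then have "((\<lambda>(y,x). \<mu> x * K x y * g y) has_sum (\<Sum>\<^sub>\<infinity>x. g x * \<mu> x)) (UNIV \<times> UNIV)"
    using 1 g by (intro has_sum_SigmaI[where g = "\<lambda>x. g x * \<mu> x"]) auto
  then show ?thesis by (subst has_sum_swap) simp
qed

lemma pair_summable_mixed:
  fixes \<mu> :: "'v \<Rightarrow> real" and K :: "'v \<Rightarrow> 'v \<Rightarrow> real"
  assumes K: "markov_kernel K" and pos: "\<And>x. \<mu> x > 0" and inv: "measure_act \<mu> K = \<mu>"
    and f: "f \<in> lp 2 \<mu>" and g: "g \<in> lp 2 \<mu>"
  shows "(\<lambda>(x,y). \<mu> x * K x y * f y * g x) summable_on (UNIV \<times> UNIV)"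
proof -
  have 1: "(\<lambda>(x,y). \<mu> x * K x y * (f y)\<^sup>2) summable_on (UNIV \<times> UNIV)"
    using f by (intro has_sum_imp_summable[OF pair_summable_snd[OF K pos inv]]) (auto simp: lp2_iff)
  have 2: "(\<lambda>(x,y). \<mu> x * K x y * (g x)\<^sup>2) summable_on (UNIV \<times> UNIV)"
    using g by (intro has_sum_imp_summable[OF pair_summable_fst[OF K pos]]) (auto simp: lp2_iff)
  have 3: "(\<lambda>z. (case z of (x,y) \<Rightarrow> \<mu> x * K x y * (f y)\<^sup>2)
            + (case z of (x,y) \<Rightarrow> \<mu> x * K x y * (g x)\<^sup>2)) summable_on (UNIV \<times> UNIV)"
    by (rule summable_on_add[OF 1 2])
  have b: "norm (\<mu> x * K x y * f y * g x) \<le> \<mu> x * K x y * (f y)\<^sup>2 + \<mu> x * K x y * (g x)\<^sup>2" for x y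
  proof -
    have "0 \<le> (\<bar>f y\<bar> - \<bar>g x\<bar>)\<^sup>2" by simp
    then have "2 * (\<bar>f y\<bar> * \<bar>g x\<bar>) \<le> (f y)\<^sup>2 + (g x)\<^sup>2" by (simp add: power2_diff)
    moreover have "0 \<le> \<bar>f y\<bar> * \<bar>g x\<bar>" by simp
    ultimately have a: "\<bar>f y\<bar> * \<bar>g x\<bar> \<le> (f y)\<^sup>2 + (g x)\<^sup>2" by linarith
    have nn: "0 \<le> \<mu> x * K x y"
      using K pos[of x] by (simp add: markov_kernel_def less_imp_le)
    have "norm (\<mu> x * K x y * f y * g x) = \<mu> x * K x y * (\<bar>f y\<bar> * \<bar>g x\<bar>)"
      using nn by (simp add: abs_mult mult.assoc) (metis abs_mult abs_of_nonneg mult.assoc)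
    also have "\<dots> \<le> \<mu> x * K x y * ((f y)\<^sup>2 + (g x)\<^sup>2)" using a nn by (rule mult_left_mono)
    finally show ?thesis by (simp add: distrib_left)
  qed
  have "(\<lambda>z. norm (case z of (x,y) \<Rightarrow> \<mu> x * K x y * f y * g x)) summable_on (UNIV \<times> UNIV)"
    by (rule summable_on_comparison_test[OF 3]) (use b in auto)
  then show ?thesis by (rule abs_summable_summable)
qed

lemma is_l2_adjoint_formula:
  fixes \<mu> :: "'v \<Rightarrow> real" and K :: "'v \<Rightarrow> 'v \<Rightarrow> real"
  assumes K: "markov_kernel K" and pos: "\<And>x. \<mu> x > 0" and inv: "measure_act \<mu> K = \<mu>"
  shows "is_l2_adjoint \<mu> K (\<lambda>x y. \<mu> y * K y x / \<mu> x)"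
  unfolding is_l2_adjoint_def
proof (intro ballI)
  fix f g assume f: "f \<in> lp 2 \<mu>" and g: "g \<in> lp 2 \<mu>"
  have "l2_inner \<mu> (fun_act K f) g = (\<Sum>\<^sub>\<infinity>x. \<Sum>\<^sub>\<infinity>y. \<mu> x * K x y * f y * g x)"
    unfolding l2_inner_def fun_act_def
    by (intro infsum_cong) (simp add: mult_ac flip: infsum_cmult_left' infsum_cmult_right')
  also have "\<dots> = (\<Sum>\<^sub>\<infinity>y. \<Sum>\<^sub>\<infinity>x. \<mu> x * K x y * f y * g x)"
    by (rule infsum_swap_banach) (use pair_summable_mixed[OF K pos inv f g] in simp)
  also have "\<dots> = l2_inner \<mu> f (fun_act (\<lambda>x y. \<mu> y * K y x / \<mu> x) g)"
    unfolding l2_inner_def fun_act_def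
  proof (intro infsum_cong)
    fix y
    have "f y * (\<Sum>\<^sub>\<infinity>x. \<mu> x * K x y / \<mu> y * g x) * \<mu> y =
          (\<Sum>\<^sub>\<infinity>x. f y * (\<mu> x * K x y / \<mu> y * g x) * \<mu> y)"
      by (simp only: infsum_cmult_left' infsum_cmult_right')
    also have "\<dots> = (\<Sum>\<^sub>\<infinity>x. \<mu> x * K x y * f y * g x)"
      using pos[of y] by (intro infsum_cong) (simp add: field_simps)
    finally show "(\<Sum>\<^sub>\<infinity>x. \<mu> x * K x y * f y * g x) =
                  f y * (\<Sum>\<^sub>\<infinity>x. \<mu> x * K x y / \<mu> y * g x) * \<mu> y" ..
  qed
  finally show "l2_inner \<mu> (fun_act K f) g = l2_inner \<mu> f (fun_act (\<lambda>x y. \<mu> y * K y x / \<mu> x) g)" .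
qed

lemma infsum_delta:
  fixes h :: "'v \<Rightarrow> real"
  assumes "\<And>x. x \<noteq> a \<Longrightarrow> h x = 0"
  shows "(\<Sum>\<^sub>\<infinity>x. h x) = h a"
proof -
  have "(\<Sum>\<^sub>\<infinity>x. h x) = (\<Sum>\<^sub>\<infinity>x\<in>{a}. h x)"
    by (rule infsum_cong_neutral) (use assms in auto)
  then show ?thesis by simp
qed

lemma delta_in_lp2: "kernel_id a \<in> lp 2 \<mu>"
  unfolding lp2_iff
  by (rule finite_nonzero_values_imp_summable_on, rule finite_subset[of _ "{a}"])
     (auto simp: kernel_id_def split: if_splits)

lemma is_l2_adjoint_unique:
  fixes \<mu> :: "'v \<Rightarrow> real"
  assumes pos: "\<And>x. \<mu> x > 0" and Q: "is_l2_adjoint \<mu> K Q"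
  shows "Q = (\<lambda>x y. \<mu> y * K y x / \<mu> x)"
proof (intro ext)
  fix x y
  have act: "fun_act L (kernel_id b) a = L a b" for L :: "'v \<Rightarrow> 'v \<Rightarrow> real" and a b
    unfolding fun_act_def by (subst infsum_delta[of b]) (auto simp: kernel_id_def)
  have "l2_inner \<mu> (fun_act K (kernel_id x)) (kernel_id y) = K y x * \<mu> y"
    unfolding l2_inner_def act by (subst infsum_delta[of y]) (auto simp: kernel_id_def)
  moreover have "l2_inner \<mu> (kernel_id x) (fun_act Q (kernel_id y)) = Q x y * \<mu> x"
    unfolding l2_inner_def act by (subst infsum_delta[of x]) (auto simp: kernel_id_def)
  ultimately have "K y x * \<mu> y = Q x y * \<mu> x"
    using Q delta_in_lp2 unfolding is_l2_adjoint_def by metis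
  then show "Q x y = \<mu> y * K y x / \<mu> x" using pos[of x] by (simp add: field_simps)
qed

lemma l2_adjoint_eq:
  fixes \<mu> :: "'v \<Rightarrow> real"
  assumes "markov_kernel K" "\<And>x. \<mu> x > 0" "measure_act \<mu> K = \<mu>"
  shows "l2_adjoint \<mu> K = (\<lambda>x y. \<mu> y * K y x / \<mu> x)"
  unfolding l2_adjoint_def
  using is_l2_adjoint_formula[OF assms] is_l2_adjoint_unique[OF assms(2)] by (rule the_equality)

lemma dirichlet_form_eq:
  fixes \<mu> :: "'v \<Rightarrow> real"
  assumes Q: "markov_kernel Q" and pos: "\<And>x. \<mu> x > 0" and inv: "measure_act \<mu> Q = \<mu>"
    and f: "f \<in> lp 2 \<mu>"
  shows "dirichlet_form Q \<mu> f = 1/2 * (\<Sum>\<^sub>\<infinity>(x,y). (f x - f y)\<^sup>2 * \<mu> x * Q x y)"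
proof -
  have s: "(\<lambda>x. (f x)\<^sup>2 * \<mu> x) summable_on UNIV" using f by (simp add: lp2_iff)
  define S where "S = (\<Sum>\<^sub>\<infinity>x. (f x)\<^sup>2 * \<mu> x)"
  define C where "C = (\<Sum>\<^sub>\<infinity>(x,y). \<mu> x * Q x y * f y * f x)"
  note m = pair_summable_mixed[OF Q pos inv f f]
  have 1: "((\<lambda>(x,y). \<mu> x * Q x y * (f x)\<^sup>2) has_sum S) (UNIV \<times> UNIV)"
    unfolding S_def by (rule pair_summable_fst[OF Q pos s]) auto
  have 2: "((\<lambda>(x,y). \<mu> x * Q x y * (f y)\<^sup>2) has_sum S) (UNIV \<times> UNIV)"
    unfolding S_def by (rule pair_summable_snd[OF Q pos inv s]) auto
  have 3: "((\<lambda>(x,y). \<mu> x * Q x y * f y * f x) has_sum C) (UNIV \<times> UNIV)"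
    using has_sum_infsum[OF m] by (simp add: C_def)
  have "((\<lambda>z. (case z of (x,y) \<Rightarrow> \<mu> x * Q x y * (f x)\<^sup>2) + (case z of (x,y) \<Rightarrow> \<mu> x * Q x y * (f y)\<^sup>2)
          + (-2) * (case z of (x,y) \<Rightarrow> \<mu> x * Q x y * f y * f x)) has_sum (S + S + (-2) * C)) (UNIV \<times> UNIV)"
    by (intro has_sum_add 1 2 has_sum_cmult_right 3)
  also have "(\<lambda>z. (case z of (x,y) \<Rightarrow> \<mu> x * Q x y * (f x)\<^sup>2) + (case z of (x,y) \<Rightarrow> \<mu> x * Q x y * (f y)\<^sup>2)
          + (-2) * (case z of (x,y) \<Rightarrow> \<mu> x * Q x y * f y * f x)) =
        (\<lambda>(x,y). (f x - f y)\<^sup>2 * \<mu> x * Q x y)"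
    by (auto simp: fun_eq_iff power2_eq_square algebra_simps)
  finally have A: "(\<Sum>\<^sub>\<infinity>(x,y). (f x - f y)\<^sup>2 * \<mu> x * Q x y) = 2 * S - 2 * C"
    by (auto dest: infsumI)
  have it: "(\<Sum>\<^sub>\<infinity>y. \<mu> x * Q x y * f y * f x) = fun_act Q f x * f x * \<mu> x" for x
    unfolding fun_act_def by (simp add: mult_ac flip: infsum_cmult_left' infsum_cmult_right')
  have "((\<lambda>x. fun_act Q f x * f x * \<mu> x) has_sum C) UNIV"
  proof -
    have "(\<lambda>x. \<Sum>\<^sub>\<infinity>y. \<mu> x * Q x y * f y * f x) summable_on UNIV"
      using summable_on_Sigma_banach[of "\<lambda>x y. \<mu> x * Q x y * f y * f x" UNIV "\<lambda>_. UNIV"] m by simp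
    moreover have "(\<Sum>\<^sub>\<infinity>x. \<Sum>\<^sub>\<infinity>y. \<mu> x * Q x y * f y * f x) = C"
      using infsum_Sigma'_banach[of "\<lambda>x y. \<mu> x * Q x y * f y * f x" UNIV "\<lambda>_. UNIV"] m
      by (simp add: C_def)
    ultimately show ?thesis unfolding it by (metis has_sum_infsum)
  qed
  then have "((\<lambda>x. (f x)\<^sup>2 * \<mu> x + (-1) * (fun_act Q f x * f x * \<mu> x)) has_sum (S + (-1) * C)) UNIV"
    by (intro has_sum_add has_sum_cmult_right) (simp_all add: S_def s has_sum_infsum)
  also have "(\<lambda>x. (f x)\<^sup>2 * \<mu> x + (-1) * (fun_act Q f x * f x * \<mu> x)) =
             (\<lambda>x. (f x - fun_act Q f x) * f x * \<mu> x)"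
    by (auto simp: fun_eq_iff power2_eq_square algebra_simps)
  finally have "dirichlet_form Q \<mu> f = S - C"
    unfolding dirichlet_form_def l2_inner_def by (auto dest: infsumI)
  then show ?thesis using A by simp
qed

lemma dirichlet_form_nonneg:
  fixes \<mu> :: "'v \<Rightarrow> real"
  assumes Q: "markov_kernel Q" and pos: "\<And>x. \<mu> x > 0" and inv: "measure_act \<mu> Q = \<mu>"
    and f: "f \<in> lp 2 \<mu>"
  shows "dirichlet_form Q \<mu> f \<ge> 0"
proof -
  have "0 \<le> (f x - f y)\<^sup>2 * \<mu> x * Q x y" for x y
    using Q pos[of x] by (simp add: markov_kernel_def less_imp_le)
  then show ?thesis
    unfolding dirichlet_form_eq[OF assms] by (auto intro!: infsum_nonneg)
qed

lemma log_sobolev_greatest: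
  fixes \<mu> :: "'v \<Rightarrow> real"
  assumes Q: "markov_kernel Q" and pos: "\<And>x. \<mu> x > 0" and inv: "measure_act \<mu> Q = \<mu>"
    and prob: "(\<mu> has_sum 1) UNIV" and two: "\<exists>x y :: 'v. x \<noteq> y"
  shows "log_sobolev_bound Q \<mu> (log_sobolev Q \<mu>)"
    and "log_sobolev_bound Q \<mu> a \<Longrightarrow> a \<le> log_sobolev Q \<mu>"
proof -
  let ?B = "Collect (log_sobolev_bound Q \<mu>)"
  have zero: "0 \<in> ?B"
    using dirichlet_form_nonneg[OF Q pos inv]
    by (auto simp: log_sobolev_bound_def simp flip: zero_ereal_def)
  obtain u v :: 'v where uv: "u \<noteq> v" using two by blast
  have ult1: "\<mu> u < 1"
  proof -
    have "(\<Sum>x\<in>{u,v}. \<mu> x) \<le> (\<Sum>\<^sub>\<infinity>x. \<mu> x)"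
      using prob pos by (intro finite_sum_le_infsum) (auto simp: summable_on_def less_imp_le)
    then show ?thesis using uv pos[of v] infsumI[OF prob] by simp
  qed
  define d where "d = kernel_id u"
  define c where "c = - ln (\<mu> u) * \<mu> u"
  have c: "c > 0" using ult1 pos[of u] by (simp add: c_def mult_neg_pos)
  have m: "(\<Sum>\<^sub>\<infinity>z. (d z)\<^sup>2 * \<mu> z) = \<mu> u"
    by (subst infsum_delta[of u]) (auto simp: d_def kernel_id_def)
  have et: "entropy_term \<mu> (\<lambda>x. (d x)\<^sup>2) x = (if x = u then c else 0)" for x
    unfolding entropy_term_def m using pos[of u]
    by (auto simp: d_def kernel_id_def c_def ln_div)
  have "entropy_term \<mu> (\<lambda>x. (d x)\<^sup>2) summable_on UNIV"
    by (rule finite_nonzero_values_imp_summable_on, rule finite_subset[of _ "{u}"])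
       (auto simp: et split: if_splits)
  moreover have "(\<Sum>\<^sub>\<infinity>x. entropy_term \<mu> (\<lambda>x. (d x)\<^sup>2) x) = c"
    by (subst infsum_delta[of u]) (auto simp: et)
  ultimately have ent: "entropy \<mu> (\<lambda>x. (d x)\<^sup>2) = ereal c" by (simp add: entropy_def)
  have dmem: "d \<in> lp 2 \<mu>" "\<And>x. d x \<ge> 0" by (auto simp: d_def delta_in_lp2) (simp add: kernel_id_def)
  have dnc: "\<not> d constant_on UNIV"
    using uv unfolding constant_on_def d_def kernel_id_def by (metis UNIV_I zero_neq_one)
  have ub: "a \<le> dirichlet_form Q \<mu> d / c" if "a \<in> ?B" for a
  proof -
    have "ereal a * ereal c \<le> ereal (dirichlet_form Q \<mu> d)"
      using that dmem dnc by (auto simp: log_sobolev_bound_def simp flip: ent)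
    then show ?thesis using c by (simp add: field_simps)
  qed
  have bdd: "bdd_above ?B" by (rule bdd_aboveI[OF ub])
  have SB: "log_sobolev_bound Q \<mu> (Sup ?B)"
  proof (rule log_sobolev_bound_def[THEN iffD2], intro conjI ballI impI)
    show S0: "0 \<le> Sup ?B" using zero bdd by (rule cSup_upper)
    fix f assume f: "f \<in> lp 2 \<mu>" and fc: "(\<forall>x. 0 \<le> f x) \<and> \<not> f constant_on UNIV"
    let ?E = "dirichlet_form Q \<mu> f"
    have H: "ereal a * entropy \<mu> (\<lambda>x. (f x)\<^sup>2) \<le> ereal ?E" if "a \<in> ?B" for a
      using that f fc by (auto simp: log_sobolev_bound_def)
    show "ereal (Sup ?B) * entropy \<mu> (\<lambda>x. (f x)\<^sup>2) \<le> ereal ?E"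
    proof (cases "entropy \<mu> (\<lambda>x. (f x)\<^sup>2)")
      case (real r)
      show ?thesis
      proof (cases "r \<le> 0")
        case True
        then have "Sup ?B * r \<le> 0" using S0 by (simp add: mult_nonneg_nonpos)
        then show ?thesis using real dirichlet_form_nonneg[OF Q pos inv f] by simp
      next
        case False
        have "Sup ?B \<le> ?E / r"
          using H zero False real by (intro cSup_least) (auto simp: field_simps)
        then show ?thesis using False real by (simp add: field_simps)
      qed
    next
      case PInf
      have "a \<le> 0" if "a \<in> ?B" for a using H[OF that] PInf by (cases "a > 0") auto
      then have "Sup ?B \<le> 0" using zero by (intro cSup_least) auto
      then have "Sup ?B = 0" using S0 by simp
      then show ?thesis using dirichlet_form_nonneg[OF Q pos inv f] by (simp flip: zero_ereal_def)
    next
      case MInf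
      then show ?thesis by (simp add: entropy_def split: if_splits)
    qed
  qed
  have up: "\<And>a. log_sobolev_bound Q \<mu> a \<Longrightarrow> a \<le> Sup ?B" using bdd by (auto intro: cSup_upper)
  have eq: "log_sobolev Q \<mu> = Sup ?B"
    unfolding log_sobolev_def using SB up by (rule Greatest_equality)
  show "log_sobolev_bound Q \<mu> (log_sobolev Q \<mu>)" using SB eq by simp
  show "log_sobolev_bound Q \<mu> a \<Longrightarrow> a \<le> log_sobolev Q \<mu>" using up eq by simp
qed

lemma kernel_comp_has_sum:
  fixes L M :: "'v \<Rightarrow> 'v \<Rightarrow> real"
  assumes L: "markov_kernel L" and M: "markov_kernel M"
  shows "((\<lambda>y. L x y * M y z) has_sum kernel_comp L M x z) UNIV"
proof -
  have "L x summable_on UNIV" using L by (auto simp: markov_kernel_def summable_on_def)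
  then have "(\<lambda>y. L x y * M y z) summable_on UNIV"
    by (rule summable_on_comparison_test)
       (use L M in \<open>auto simp: markov_kernel_def intro: mult_left_le\<close>)
  then show ?thesis by (simp add: kernel_comp_def)
qed

lemma markov_kernel_comp:
  fixes L M :: "'v \<Rightarrow> 'v \<Rightarrow> real"
  assumes L: "markov_kernel L" and M: "markov_kernel M"
  shows "markov_kernel (kernel_comp L M)"
proof -
  note h = kernel_comp_has_sum[OF L M]
  have nn: "0 \<le> L x y * M y z" for x y z using L M by (simp add: markov_kernel_def)
  have 1: "((\<lambda>z. L x y * M y z) has_sum L x y) UNIV" for x y
    using has_sum_cmult_right[where f = "M y" and a = 1 and A = UNIV and c = "L x y"] M by (simp add: markov_kernel_def)
  have 2: "(kernel_comp L M x has_sum 1) UNIV" for x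
  proof -
    have Lx: "(L x has_sum 1) UNIV" using L by (simp add: markov_kernel_def)
    have "(\<lambda>(y,z). L x y * M y z) summable_on (UNIV \<times> UNIV)"
      using 1 Lx nn by (intro summable_on_SigmaI[where g = "L x"]) (auto simp: summable_on_def)
    then have "((\<lambda>(y,z). L x y * M y z) has_sum 1) (UNIV \<times> UNIV)"
      using 1 Lx by (intro has_sum_SigmaI[where g = "L x"]) auto
    then have "((\<lambda>(z,y). L x y * M y z) has_sum 1) (UNIV \<times> UNIV)"
      by (subst has_sum_swap) simp
    then show ?thesis by (rule has_sum_SigmaD) (simp add: h)
  qed
  have 3: "0 \<le> kernel_comp L M x z" for x z
    unfolding kernel_comp_def using nn by (auto intro: infsum_nonneg)
  have "kernel_comp L M x z \<le> 1" for x z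
    using h[of x z] L M
    by (intro has_sum_mono[OF h[of x z], of "L x" 1])
       (auto simp: markov_kernel_def intro: mult_left_le)
  then show ?thesis using 2 3 by (simp add: markov_kernel_def)
qed

lemma measure_act_comp:
  fixes \<mu> :: "'v \<Rightarrow> real"
  assumes pos: "\<And>x. \<mu> x > 0" and L: "markov_kernel L" and M: "markov_kernel M"
    and iL: "measure_act \<mu> L = \<mu>" and iM: "measure_act \<mu> M = \<mu>"
  shows "measure_act \<mu> (kernel_comp L M) = \<mu>"
proof
  fix z
  have nn: "0 \<le> \<mu> x * (L x y * M y z)" for x y
    using L M pos[of x] by (simp add: markov_kernel_def less_imp_le)
  have 1: "((\<lambda>x. \<mu> x * (L x y * M y z)) has_sum (\<mu> y * M y z)) UNIV" for y
    using has_sum_cmult_left[OF measure_act_has_sum[OF pos iL, of y], where c = "M y z"]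
    by (simp add: mult.assoc)
  note m = measure_act_has_sum[OF pos iM, of z]
  have "(\<lambda>(y,x). \<mu> x * (L x y * M y z)) summable_on (UNIV \<times> UNIV)"
    using 1 m nn by (intro summable_on_SigmaI[where g = "\<lambda>y. \<mu> y * M y z"]) (auto simp: summable_on_def)
  then have "((\<lambda>(y,x). \<mu> x * (L x y * M y z)) has_sum \<mu> z) (UNIV \<times> UNIV)"
    using 1 m by (intro has_sum_SigmaI[where g = "\<lambda>y. \<mu> y * M y z"]) auto
  then have d: "((\<lambda>(x,y). \<mu> x * (L x y * M y z)) has_sum \<mu> z) (UNIV \<times> UNIV)"
    by (subst has_sum_swap) simp
  have c: "((\<lambda>y. \<mu> x * (L x y * M y z)) has_sum (\<mu> x * kernel_comp L M x z)) UNIV" for x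
    by (intro has_sum_cmult_right kernel_comp_has_sum L M)
  have "((\<lambda>x. \<mu> x * kernel_comp L M x z) has_sum \<mu> z) UNIV"
    by (rule has_sum_SigmaD[OF d]) (simp add: c)
  then show "measure_act \<mu> (kernel_comp L M) z = \<mu> z"
    unfolding measure_act_def by (rule infsumI)
qed

lemma l2_adjoint_markov:
  fixes \<mu> :: "'v \<Rightarrow> real"
  assumes K: "markov_kernel K" and pos: "\<And>x. \<mu> x > 0" and inv: "measure_act \<mu> K = \<mu>"
  shows "markov_kernel (l2_adjoint \<mu> K)" and "measure_act \<mu> (l2_adjoint \<mu> K) = \<mu>"
proof -
  let ?Q = "\<lambda>x y. \<mu> y * K y x / \<mu> x"
  have nn: "0 \<le> \<mu> y * K y x" for x y
    using K pos[of y] by (simp add: markov_kernel_def less_imp_le)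
  have h: "((\<lambda>x. \<mu> x * K x y) has_sum \<mu> y) UNIV" for y by (rule measure_act_has_sum[OF pos inv])
  have s: "(?Q x has_sum 1) UNIV" for x
    using has_sum_cmult_left[OF h[of x], where c = "1 / \<mu> x"] pos[of x] by simp
  have "?Q x y \<le> 1" for x y
  proof -
    have "(\<Sum>y\<in>{y}. ?Q x y) \<le> (\<Sum>\<^sub>\<infinity>y. ?Q x y)"
      using s[of x] nn pos[of x]
      by (intro finite_sum_le_infsum) (auto simp: summable_on_def less_imp_le)
    then show ?thesis using infsumI[OF s[of x]] by simp
  qed
  then have "markov_kernel ?Q"
    using s nn pos by (simp add: markov_kernel_def less_imp_le)
  then show "markov_kernel (l2_adjoint \<mu> K)" by (simp add: l2_adjoint_eq[OF assms])
  have "measure_act \<mu> ?Q y = \<mu> y" for y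
  proof -
    have e: "\<mu> x * ?Q x y = \<mu> y * K y x" for x using pos[of x] by simp
    have "((\<lambda>x. \<mu> y * K y x) has_sum \<mu> y) UNIV"
      using has_sum_cmult_right[where f = "K y" and a = 1 and A = UNIV and c = "\<mu> y"] K by (simp add: markov_kernel_def)
    then show ?thesis unfolding measure_act_def e by (rule infsumI)
  qed
  then show "measure_act \<mu> (l2_adjoint \<mu> K) = \<mu>" by (auto simp: l2_adjoint_eq[OF assms])
qed

lemma env_log_sobolev_greatest:
  fixes K :: "nat \<Rightarrow> 'v \<Rightarrow> 'v \<Rightarrow> real"
  assumes env: "finite_nondecreasing_env K \<pi>" and t: "t \<ge> 1" and two: "\<exists>x y :: 'v. x \<noteq> y"
  defines "\<mu> \<equiv> normalized (\<pi> t)"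
  defines "Q \<equiv> kernel_comp (l2_adjoint \<mu> (K t)) (K t)"
  shows "log_sobolev_bound Q \<mu> (env_log_sobolev K \<pi> t)"
    and "log_sobolev_bound Q \<mu> a \<Longrightarrow> a \<le> env_log_sobolev K \<pi> t"
proof -
  have K: "markov_kernel (K t)" and p: "\<And>x. \<pi> t x > 0" and i: "measure_act (\<pi> t) (K t) = \<pi> t"
    and s: "\<pi> t summable_on UNIV"
    using env t by (auto simp: finite_nondecreasing_env_def)
  have m: "mass (\<pi> t) > 0"
  proof -
    fix x
    have "(\<Sum>x\<in>{x}. \<pi> t x) \<le> mass (\<pi> t)"
      unfolding mass_def using p s by (intro finite_sum_le_infsum) (auto simp: less_imp_le)
    then show ?thesis using p[of x] by simp
  qed
  have pos: "\<And>x. \<mu> x > 0" using p m by (simp add: \<mu>_def normalized_def)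
  have eq: "\<mu> x = \<pi> t x * (1 / mass (\<pi> t))" for x by (simp add: \<mu>_def normalized_def)
  have prob: "(\<mu> has_sum 1) UNIV"
    using has_sum_cmult_left[OF has_sum_infsum[OF s], where c = "1 / mass (\<pi> t)"] m
    unfolding eq[abs_def] by (simp add: mass_def)
  have inv: "measure_act \<mu> (K t) = \<mu>"
  proof
    fix y
    have "((\<lambda>x. \<mu> x * K t x y) has_sum \<mu> y) UNIV"
      using has_sum_cmult_left[OF measure_act_has_sum[OF p i, of y], where c = "1 / mass (\<pi> t)"]
      by (simp add: eq mult_ac)
    then show "measure_act \<mu> (K t) y = \<mu> y" unfolding measure_act_def by (rule infsumI)
  qed
  note A = l2_adjoint_markov[OF K pos inv]
  have Q: "markov_kernel Q" unfolding Q_def by (rule markov_kernel_comp[OF A(1) K])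
  have Qinv: "measure_act \<mu> Q = \<mu>"
    unfolding Q_def by (rule measure_act_comp[OF pos A(1) K A(2) inv])
  have e: "env_log_sobolev K \<pi> t = log_sobolev Q \<mu>"
    by (simp add: env_log_sobolev_def Q_def \<mu>_def)
  show "log_sobolev_bound Q \<mu> (env_log_sobolev K \<pi> t)"
    and "log_sobolev_bound Q \<mu> a \<Longrightarrow> a \<le> env_log_sobolev K \<pi> t"
    unfolding e by (rule log_sobolev_greatest[OF Q pos Qinv prob two], assumption?)+
qed

end

theory Submission
  imports Defs
begin

text \<open>
  Applied to a function \<open>u\<close>, the logarithmic Sobolev inequality for \<open>K\<^sup>*K\<close> bounds \<open>\<parallel>Ku\<parallel>\<^sub>2\<^sup>2\<close> by
  \<open>\<parallel>u\<parallel>\<^sub>2\<^sup>2 - a L(u\<^sup>2)\<close>, which is at most \<open>\<parallel>u\<parallel>\<^sub>r\<^sup>2\<close> for \<open>r = 2/(1+a)\<close>. With \<open>u = f\<^sup>s\<close>,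
  \<open>s = q(1+a)/2 \<ge> 1\<close>, and \<open>(Kf)\<^sup>s \<le> K(f\<^sup>s)\<close>, this gives that \<open>K\<close> is a contraction from
  $\ell^q$ to $\ell^{q(1+a)}$; only \<open>u\<close> of finite support are needed, by monotone convergence.
  Passing from one reference measure to the preceding, smaller one costs the ratio of their masses
  to the power \<open>1/(q(1+a)) \<le> 1/q\<close>, and these ratios telescope.
\<close>

section \<open>Convexity of powers\<close>

lemma powr_ge_tangent:
  fixes u m s :: real
  assumes s: "s \<ge> 1" and u: "u \<ge> 0" and m: "m > 0"
  shows "m powr s + s * m powr (s - 1) * (u - m) \<le> u powr s"
proof (cases "s = 1")
  case True
  then show ?thesis using u m by simp
next
  case False
  with s have s1: "s > 1" by simp
  have "(u / m) * 1 \<le> (u / m) powr s / s + 1 powr (s / (s - 1)) / (s / (s - 1))"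
    by (rule Youngs_inequality) (use s1 u m in \<open>auto simp: field_simps\<close>)
  then have "s * (u / m) \<le> s * ((u / m) powr s / s + (s - 1) / s)"
    using s1 by (intro mult_left_mono) auto
  also have "\<dots> = (u / m) powr s + (s - 1)"
    using s1 by (simp add: distrib_left)
  finally have "s * (u / m) \<le> (u / m) powr s + (s - 1)" .
  then have "(s * (u / m)) * m powr s \<le> ((u / m) powr s + (s - 1)) * m powr s"
    by (rule mult_right_mono) simp
  also have "\<dots> = u powr s + (s - 1) * m powr s"
    using u m by (simp add: powr_divide field_simps)
  finally have "s * (u / m) * m powr s \<le> u powr s + (s - 1) * m powr s" .
  moreover have "s * m powr (s - 1) * (u - m) = s * (u / m) * m powr s - s * m powr s"
    using m by (simp add: powr_diff field_simps)
  ultimately show ?thesis by (simp add: algebra_simps)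
qed

lemma powr_infsum_le:
  fixes w u :: "'a \<Rightarrow> real"
  assumes w: "(w has_sum 1) UNIV" and w0: "\<And>x. w x \<ge> 0" and u0: "\<And>x. u x \<ge> 0"
    and s: "s \<ge> 1" and us: "(\<lambda>x. u x powr s * w x) summable_on UNIV"
  shows "(\<lambda>x. u x * w x) summable_on UNIV"
    and "(\<Sum>\<^sub>\<infinity>x. u x * w x) powr s \<le> (\<Sum>\<^sub>\<infinity>x. u x powr s * w x)"
proof -
  have ws: "w summable_on UNIV" using w by (auto simp: summable_on_def)
  show sm: "(\<lambda>x. u x * w x) summable_on UNIV"
  proof (rule summable_on_comparison_test)
    show "(\<lambda>x. u x powr s * w x + s * w x) summable_on UNIV"
      by (intro summable_on_add us summable_on_cmult_right ws)
    fix x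
    have "s * u x \<le> u x powr s + s"
      using powr_ge_tangent[OF s u0[of x], of 1] by (simp add: algebra_simps)
    moreover have "u x \<le> s * u x" using s u0[of x] by (simp add: mult_le_cancel_right1)
    ultimately have "u x * w x \<le> (u x powr s + s) * w x"
      using w0[of x] by (intro mult_right_mono) auto
    then show "u x * w x \<le> u x powr s * w x + s * w x" by (simp add: algebra_simps)
    show "0 \<le> u x * w x" using u0 w0 by simp
  qed
  define m where "m = (\<Sum>\<^sub>\<infinity>x. u x * w x)"
  have m0: "m \<ge> 0" unfolding m_def using u0 w0 by (intro infsum_nonneg) simp
  show "m powr s \<le> (\<Sum>\<^sub>\<infinity>x. u x powr s * w x)"
  proof (cases "m = 0")
    case True
    then show ?thesis using w0 by (auto intro!: infsum_nonneg)
  next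
    case False
    with m0 have mp: "m > 0" by simp
    define c where "c = s * m powr (s - 1)"
    have "((\<lambda>x. c * (u x * w x) + (m powr s - c * m) * w x) has_sum (c * m + (m powr s - c * m) * 1)) UNIV"
      unfolding m_def by (intro has_sum_add has_sum_cmult_right w has_sum_infsum sm)
    then have "c * m + (m powr s - c * m) * 1 \<le> (\<Sum>\<^sub>\<infinity>x. u x powr s * w x)"
    proof (rule has_sum_mono[OF _ has_sum_infsum[OF us]])
      fix x
      have "(m powr s + c * (u x - m)) * w x \<le> u x powr s * w x"
        unfolding c_def by (intro mult_right_mono powr_ge_tangent s u0 mp w0)
      then show "c * (u x * w x) + (m powr s - c * m) * w x \<le> u x powr s * w x"
        by (simp add: algebra_simps)
    qed
    then show ?thesis by simp
  qed
qed

lemma has_sum_finite_support: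
  assumes "finite A" "\<And>x. x \<notin> A \<Longrightarrow> h x = 0"
  shows "(h has_sum (sum h A)) UNIV"
  by (rule has_sum_finite_neutralI) (use assms in auto)

lemma has_sum_sum:
  fixes f :: "'i \<Rightarrow> 'a \<Rightarrow> real"
  assumes "\<And>i. i \<in> I \<Longrightarrow> (f i has_sum s i) A"
  shows "((\<lambda>x. \<Sum>i\<in>I. f i x) has_sum (\<Sum>i\<in>I. s i)) A"
  using assms by (induction I rule: infinite_finite_induct) (auto intro: has_sum_add has_sum_0)

section \<open>One step of the chain\<close>

locale invariant_probability =
  fixes \<mu> :: "'v \<Rightarrow> real" and K :: "'v \<Rightarrow> 'v \<Rightarrow> real"
  assumes markov: "markov_kernel K"
    and pos: "\<And>x. \<mu> x > 0"
    and prob: "(\<mu> has_sum 1) UNIV"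
    and inv: "measure_act \<mu> K = \<mu>"
begin

lemma K0: "0 \<le> K x y" and K1: "K x y \<le> 1" and Ksum: "(K x has_sum 1) UNIV"
  using markov by (auto simp: markov_kernel_def)

lemma mu0: "0 \<le> \<mu> x"
  using pos[of x] by simp

lemma \<mu>_summable: "\<mu> summable_on UNIV"
  using prob by (auto simp: summable_on_def)

lemma lp_antimono:
  assumes "1 \<le> p" "p \<le> r" "f \<in> lp r \<mu>"
  shows "f \<in> lp p \<mu>" and "lp_norm p \<mu> f \<le> lp_norm r \<mu> f"
proof -
  have e: "(\<bar>f x\<bar> powr p) powr (r / p) = \<bar>f x\<bar> powr r" for x
    using assms by (simp add: powr_powr)
  have s: "(\<lambda>x. (\<bar>f x\<bar> powr p) powr (r / p) * \<mu> x) summable_on UNIV"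
    using assms(3) by (simp add: e lp_def)
  have rp: "r / p \<ge> 1" using assms by simp
  note J = powr_infsum_le[OF prob mu0 _ rp s]
  show "f \<in> lp p \<mu>" using J(1) by (simp add: lp_def)
  have nn: "0 \<le> (\<Sum>\<^sub>\<infinity>x. \<bar>f x\<bar> powr p * \<mu> x)"
    using mu0 by (intro infsum_nonneg) simp
  have "(\<Sum>\<^sub>\<infinity>x. \<bar>f x\<bar> powr p * \<mu> x) powr (r / p) \<le> (\<Sum>\<^sub>\<infinity>x. \<bar>f x\<bar> powr r * \<mu> x)"
    using J(2) by (simp add: e)
  then have "((\<Sum>\<^sub>\<infinity>x. \<bar>f x\<bar> powr p * \<mu> x) powr (r / p)) powr (1 / r)
      \<le> (\<Sum>\<^sub>\<infinity>x. \<bar>f x\<bar> powr r * \<mu> x) powr (1 / r)"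
    using assms by (intro powr_mono2) auto
  then show "lp_norm p \<mu> f \<le> lp_norm r \<mu> f"
    using assms nn by (simp add: lp_norm_def powr_powr)
qed

lemma kernel_summable:
  assumes q: "q \<ge> 1" and f: "f \<in> lp q \<mu>"
  shows "(\<lambda>y. K x y * \<bar>f y\<bar>) summable_on UNIV"
proof -
  have "f \<in> lp 1 \<mu>" using lp_antimono(1)[OF _ q f] by simp
  then have s: "(\<lambda>y. \<bar>f y\<bar> * \<mu> y) summable_on UNIV" by (simp add: lp_def)
  show ?thesis
  proof (rule summable_on_comparison_test)
    show "(\<lambda>y. (1 / \<mu> x) * (\<bar>f y\<bar> * \<mu> y)) summable_on UNIV"
      by (rule summable_on_cmult_right[OF s])
    fix y
    note h = measure_act_has_sum[OF pos inv, of y]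
    have "(\<Sum>x\<in>{x}. \<mu> x * K x y) \<le> (\<Sum>\<^sub>\<infinity>x. \<mu> x * K x y)"
      using h mu0 K0 by (intro finite_sum_le_infsum) (auto simp: summable_on_def)
    then have "\<mu> x * K x y \<le> \<mu> y" using infsumI[OF h] by simp
    then have "K x y \<le> (1 / \<mu> x) * \<mu> y" using pos[of x] by (simp add: field_simps)
    then have "K x y * \<bar>f y\<bar> \<le> (1 / \<mu> x) * \<mu> y * \<bar>f y\<bar>" by (rule mult_right_mono) simp
    then show "K x y * \<bar>f y\<bar> \<le> (1 / \<mu> x) * (\<bar>f y\<bar> * \<mu> y)" by (simp add: mult_ac)
    show "0 \<le> K x y * \<bar>f y\<bar>" using K0 by simp
  qed
qed

lemma fun_act_finite:
  assumes "finite A" "{x. u x \<noteq> 0} \<subseteq> A"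
  shows "fun_act L u x = (\<Sum>y\<in>A. L x y * u y)"
  unfolding fun_act_def by (rule infsumI, rule has_sum_finite_support) (use assms in auto)

lemma finite_support_in_lp2:
  assumes "finite A" "{x. u x \<noteq> 0} \<subseteq> A"
  shows "u \<in> lp 2 \<mu>"
  unfolding lp2_iff
  by (rule has_sum_imp_summable, rule has_sum_finite_support[OF assms(1)]) (use assms(2) in auto)

lemma fun_act_in_lp2:
  assumes "finite A" "{x. u x \<noteq> 0} \<subseteq> A"
  shows "fun_act K u \<in> lp 2 \<mu>"
  unfolding lp2_iff
proof (rule summable_on_comparison_test)
  define B where "B = (\<Sum>y\<in>A. \<bar>u y\<bar>)"
  show "(\<lambda>x. B\<^sup>2 * \<mu> x) summable_on UNIV"
    by (rule summable_on_cmult_right[OF \<mu>_summable])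
  fix x
  have "\<bar>fun_act K u x\<bar> \<le> (\<Sum>y\<in>A. \<bar>K x y * u y\<bar>)"
    unfolding fun_act_finite[OF assms] by (rule sum_abs)
  also have "\<dots> \<le> B"
    unfolding B_def using K0 K1 by (intro sum_mono) (simp add: abs_mult mult_left_le_one_le)
  finally have "\<bar>fun_act K u x\<bar>\<^sup>2 \<le> B\<^sup>2" by (rule power_mono) simp
  then show "(fun_act K u x)\<^sup>2 * \<mu> x \<le> B\<^sup>2 * \<mu> x" using mu0 by (simp add: mult_right_mono)
  show "0 \<le> (fun_act K u x)\<^sup>2 * \<mu> x" using mu0 by simp
qed

lemma dirichlet_form_adjoint_comp:
  assumes A: "finite A" "{x. u x \<noteq> 0} \<subseteq> A"
  shows "dirichlet_form (kernel_comp (l2_adjoint \<mu> K) K) \<mu> u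
           = (\<Sum>x\<in>A. (u x)\<^sup>2 * \<mu> x) - (\<Sum>\<^sub>\<infinity>x. (fun_act K u x)\<^sup>2 * \<mu> x)"
proof -
  let ?L = "l2_adjoint \<mu> K"
  note adj = l2_adjoint_markov[OF markov pos inv]
  have adjoint: "is_l2_adjoint \<mu> K ?L"
    using is_l2_adjoint_formula[OF markov pos inv] l2_adjoint_eq[OF markov pos inv] by simp
  have comp: "fun_act (kernel_comp ?L K) u x = fun_act ?L (fun_act K u) x" for x
  proof -
    have "((\<lambda>y. \<Sum>z\<in>A. (?L x y * K y z) * u z) has_sum (\<Sum>z\<in>A. kernel_comp ?L K x z * u z)) UNIV"
      by (intro has_sum_sum has_sum_cmult_left kernel_comp_has_sum adj markov)
    moreover have "(\<lambda>y. \<Sum>z\<in>A. (?L x y * K y z) * u z) = (\<lambda>y. ?L x y * fun_act K u y)"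
      by (simp add: fun_act_finite[OF A] sum_distrib_left mult.assoc)
    ultimately show ?thesis
      by (simp add: fun_act_finite[OF A, of "kernel_comp ?L K"] fun_act_def[of ?L] infsumI)
  qed
  have "(\<Sum>\<^sub>\<infinity>x. (fun_act K u x)\<^sup>2 * \<mu> x) = l2_inner \<mu> (fun_act K u) (fun_act K u)"
    by (simp add: l2_inner_def power2_eq_square)
  also have "\<dots> = l2_inner \<mu> u (fun_act ?L (fun_act K u))"
    using adjoint finite_support_in_lp2[OF A] fun_act_in_lp2[OF A] by (simp add: is_l2_adjoint_def)
  also have "\<dots> = (\<Sum>x\<in>A. u x * fun_act ?L (fun_act K u) x * \<mu> x)"
    unfolding l2_inner_def by (rule infsumI, rule has_sum_finite_support) (use A in auto)
  finally have 1: "(\<Sum>\<^sub>\<infinity>x. (fun_act K u x)\<^sup>2 * \<mu> x) = \<dots>" .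
  have "dirichlet_form (kernel_comp ?L K) \<mu> u
      = (\<Sum>x\<in>A. (u x - fun_act ?L (fun_act K u) x) * u x * \<mu> x)"
    unfolding dirichlet_form_def l2_inner_def comp
    by (rule infsumI, rule has_sum_finite_support) (use A in auto)
  then show ?thesis
    unfolding 1 by (simp add: sum_subtractf[symmetric] power2_eq_square algebra_simps)
qed

lemma log_sobolev_finite_support:
  assumes LS: "log_sobolev_bound (kernel_comp (l2_adjoint \<mu> K) K) \<mu> a"
    and A: "finite A" "{x. u x \<noteq> 0} \<subseteq> A" and u0: "\<And>x. u x \<ge> 0"
  defines "S \<equiv> \<Sum>x\<in>A. (u x)\<^sup>2 * \<mu> x"
  shows "a * (\<Sum>x\<in>A. (u x)\<^sup>2 * ln ((u x)\<^sup>2 / S) * \<mu> x) \<le> S - (\<Sum>\<^sub>\<infinity>x. (fun_act K u x)\<^sup>2 * \<mu> x)"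
proof (cases "u constant_on UNIV")
  case True
  then obtain c where c: "\<And>x. u x = c" by (auto simp: constant_on_def)
  have S: "((\<lambda>x. (u x)\<^sup>2 * \<mu> x) has_sum S) UNIV"
    unfolding S_def by (rule has_sum_finite_support[OF A(1)]) (use A(2) in auto)
  have "((\<lambda>x. (u x)\<^sup>2 * \<mu> x) has_sum c\<^sup>2 * 1) UNIV"
    unfolding c by (intro has_sum_cmult_right prob)
  then have Sc: "S = c\<^sup>2" using has_sum_unique[OF S] by simp
  have "fun_act K u x = c" for x
    using has_sum_cmult_left[OF Ksum[of x], of c] unfolding fun_act_def c by (simp add: infsumI)
  then have "(\<Sum>\<^sub>\<infinity>x. (fun_act K u x)\<^sup>2 * \<mu> x) = S"
    using infsumI[OF S] c by simp
  moreover have "(u x)\<^sup>2 * ln ((u x)\<^sup>2 / S) * \<mu> x = 0" for x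
    by (cases "c = 0") (auto simp: c Sc)
  then have "(\<Sum>x\<in>A. (u x)\<^sup>2 * ln ((u x)\<^sup>2 / S) * \<mu> x) = 0" by (intro sum.neutral) blast
  ultimately show ?thesis by simp
next
  case False
  let ?L = "kernel_comp (l2_adjoint \<mu> K) K"
  have S: "(\<Sum>\<^sub>\<infinity>x. (u x)\<^sup>2 * \<mu> x) = S"
    unfolding S_def by (rule infsumI, rule has_sum_finite_support[OF A(1)]) (use A(2) in auto)
  have "(entropy_term \<mu> (\<lambda>x. (u x)\<^sup>2) has_sum (sum (entropy_term \<mu> (\<lambda>x. (u x)\<^sup>2)) A)) UNIV"
    by (rule has_sum_finite_support[OF A(1)]) (use A(2) in \<open>auto simp: entropy_term_def\<close>)
  then have "entropy \<mu> (\<lambda>x. (u x)\<^sup>2) = ereal (sum (entropy_term \<mu> (\<lambda>x. (u x)\<^sup>2)) A)"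
    unfolding entropy_def using infsumI has_sum_imp_summable by fastforce
  also have "\<dots> = ereal (\<Sum>x\<in>A. (u x)\<^sup>2 * ln ((u x)\<^sup>2 / S) * \<mu> x)"
    by (simp add: entropy_term_def S)
  finally have ent: "entropy \<mu> (\<lambda>x. (u x)\<^sup>2) = \<dots>" .
  have "ereal a * entropy \<mu> (\<lambda>x. (u x)\<^sup>2) \<le> ereal (dirichlet_form ?L \<mu> u)"
    using LS False u0 finite_support_in_lp2[OF A] by (auto simp: log_sobolev_bound_def)
  then show ?thesis unfolding ent dirichlet_form_adjoint_comp[OF A] S_def by simp
qed

text \<open>
  The norm \<open>\<parallel>u\<parallel>\<^sub>r\<close> is log-convex in \<open>1/r\<close>, with logarithmic derivative given by the entropy at
  \<open>r = 2\<close>. Bounding it from below by its tangent at \<open>1/2\<close> turns the logarithmic Sobolev inequality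
  into contractivity from exponent \<open>2/(1+a)\<close> to exponent \<open>2\<close>.
\<close>

lemma contraction_below_two:
  assumes LS: "log_sobolev_bound (kernel_comp (l2_adjoint \<mu> K) K) \<mu> a"
    and A: "finite A" "{x. u x \<noteq> 0} \<subseteq> A" and u0: "\<And>x. u x \<ge> 0"
  shows "(\<Sum>\<^sub>\<infinity>x. (fun_act K u x)\<^sup>2 * \<mu> x) \<le> (\<Sum>x\<in>A. u x powr (2 / (1 + a)) * \<mu> x) powr (1 + a)"
proof -
  have a0: "a \<ge> 0" using LS by (simp add: log_sobolev_bound_def)
  define S where "S = (\<Sum>x\<in>A. (u x)\<^sup>2 * \<mu> x)"
  define L where "L = (\<Sum>x\<in>A. (u x)\<^sup>2 * ln ((u x)\<^sup>2 / S) * \<mu> x)"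
  define b where "b = a / (1 + a)"
  have LSu: "(\<Sum>\<^sub>\<infinity>x. (fun_act K u x)\<^sup>2 * \<mu> x) \<le> S - a * L"
    using log_sobolev_finite_support[OF LS A u0] unfolding S_def L_def by simp
  have S0: "S \<ge> 0" unfolding S_def using mu0 by (intro sum_nonneg) simp
  show ?thesis
  proof (cases "S = 0")
    case True
    then have "L = 0" by (simp add: L_def)
    then have "S - a * L = 0" using True by simp
    also have "0 \<le> (\<Sum>x\<in>A. u x powr (2 / (1 + a)) * \<mu> x) powr (1 + a)" by simp
    finally show ?thesis using LSu by linarith
  next
    case False
    with S0 have Sp: "S > 0" by simp
    define W where "W = S powr (1 / (1 + a)) * exp (- b * L / S)"
    have W_le: "W \<le> (\<Sum>x\<in>A. u x powr (2 / (1 + a)) * \<mu> x)"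
    proof -
      define C where "C = S powr (- b) * exp (- b * L / S)"
      have t: "C * ((u x)\<^sup>2 * \<mu> x) + C * (b * L / S) * ((u x)\<^sup>2 * \<mu> x)
                 - C * b * ((u x)\<^sup>2 * ln ((u x)\<^sup>2 / S) * \<mu> x)
               \<le> u x powr (2 / (1 + a)) * \<mu> x" for x
      proof (cases "u x = 0")
        case True then show ?thesis by simp
      next
        case False
        with u0[of x] have up: "u x > 0" by simp
        define l where "l = ln ((u x)\<^sup>2 / S)"
        have lS: "l = 2 * ln (u x) - ln S"
          using up Sp by (simp add: l_def ln_div ln_realpow)
        have "C * (1 + (b * L / S - b * l)) \<le> C * exp (b * L / S - b * l)"
          by (intro mult_left_mono exp_ge_add_one_self) (simp add: C_def)
        also have "\<dots> = exp (- b * ln S - b * l)"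
          using Sp by (simp add: C_def powr_def flip: exp_add)
        also have "\<dots> = exp (- 2 * b * ln (u x))" by (simp add: lS algebra_simps)
        finally have "(u x)\<^sup>2 * (C * (1 + (b * L / S - b * l))) \<le> (u x)\<^sup>2 * exp (- 2 * b * ln (u x))"
          by (rule mult_left_mono) simp
        also have "(u x)\<^sup>2 = exp (2 * ln (u x))"
          using up by (simp add: exp_double)
        also have "exp (2 * ln (u x)) * exp (- 2 * b * ln (u x)) = exp ((2 - 2 * b) * ln (u x))"
          by (simp add: algebra_simps flip: exp_add)
        also have "2 - 2 * b = 2 / (1 + a)" using a0 by (simp add: b_def field_simps)
        also have "exp (2 / (1 + a) * ln (u x)) = u x powr (2 / (1 + a))"
          using up by (simp add: powr_def)
        finally have "exp (2 * ln (u x)) * (C * (1 + (b * L / S - b * l))) \<le> u x powr (2 / (1 + a))" .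
        then have "(u x)\<^sup>2 * (C * (1 + (b * L / S - b * l))) * \<mu> x \<le> u x powr (2 / (1 + a)) * \<mu> x"
          using up mu0 by (intro mult_right_mono) (simp_all add: exp_double)
        then show ?thesis by (simp add: l_def algebra_simps)
      qed
      have "C * S + C * (b * L / S) * S - C * b * L
            = (\<Sum>x\<in>A. C * ((u x)\<^sup>2 * \<mu> x) + C * (b * L / S) * ((u x)\<^sup>2 * \<mu> x)
                 - C * b * ((u x)\<^sup>2 * ln ((u x)\<^sup>2 / S) * \<mu> x))"
        by (simp only: sum_subtractf sum.distrib flip: sum_distrib_left S_def L_def)
      also have "\<dots> \<le> (\<Sum>x\<in>A. u x powr (2 / (1 + a)) * \<mu> x)"
        by (intro sum_mono t)
      finally have "C * S \<le> (\<Sum>x\<in>A. u x powr (2 / (1 + a)) * \<mu> x)" using Sp by simp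
      moreover have "S powr (- b) * S = S powr (1 / (1 + a))"
      proof -
        have "1 / (1 + a) = - b + 1" using a0 by (simp add: b_def field_simps)
        then show ?thesis using Sp by (simp only: powr_add) simp
      qed
      then have "W = C * S" by (simp add: W_def C_def)
      ultimately show ?thesis by simp
    qed
    have "S - a * L = S * (1 + (- a * L / S))" using Sp by (simp add: field_simps)
    also have "\<dots> \<le> S * exp (- a * L / S)"
      using Sp by (intro mult_left_mono exp_ge_add_one_self) simp
    also have "\<dots> = W powr (1 + a)"
    proof -
      have "(1 + a) * (- b * L / S) = - a * L / S" using a0 by (simp add: b_def)
      then show ?thesis
        using Sp a0 by (simp add: W_def powr_mult powr_powr exp_powr_real mult_ac) metis
    qed
    also have "\<dots> \<le> (\<Sum>x\<in>A. u x powr (2 / (1 + a)) * \<mu> x) powr (1 + a)"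
      using W_le a0 by (intro powr_mono2) (auto simp: W_def)
    finally show ?thesis using LSu by linarith
  qed
qed

lemma hypercontractive_finite_support:
  assumes LS: "log_sobolev_bound (kernel_comp (l2_adjoint \<mu> K) K) \<mu> a"
    and A: "finite A" "{x. f x \<noteq> 0} \<subseteq> A" and f0: "\<And>x. f x \<ge> 0"
    and q: "q * (1 + a) \<ge> 2" and B: "finite B"
  shows "(\<Sum>x\<in>B. (fun_act K f x) powr (q * (1 + a)) * \<mu> x) \<le> (\<Sum>x\<in>A. f x powr q * \<mu> x) powr (1 + a)"
proof -
  have a0: "a \<ge> 0" using LS by (simp add: log_sobolev_bound_def)
  define s where "s = q * (1 + a) / 2"
  have s1: "s \<ge> 1" using q by (simp add: s_def)
  define u where "u x = f x powr s" for x
  have uA: "{x. u x \<noteq> 0} \<subseteq> A" using A(2) by (auto simp: u_def)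
  have u0: "u x \<ge> 0" for x by (simp add: u_def)
  have Kf0: "fun_act K f x \<ge> 0" for x
    unfolding fun_act_def using K0 f0 by (intro infsum_nonneg) simp
  have le: "(fun_act K f x) powr s \<le> fun_act K u x" for x
  proof -
    have "(\<lambda>y. f y powr s * K x y) summable_on UNIV"
      by (rule has_sum_imp_summable, rule has_sum_finite_support[OF A(1)]) (use A(2) in auto)
    from powr_infsum_le(2)[OF Ksum K0 f0 s1 this]
    show ?thesis by (simp add: fun_act_def u_def mult_ac)
  qed
  have "(\<Sum>x\<in>B. (fun_act K f x) powr (q * (1 + a)) * \<mu> x) \<le> (\<Sum>x\<in>B. (fun_act K u x)\<^sup>2 * \<mu> x)"
  proof (rule sum_mono)
    fix x
    have "(fun_act K f x) powr (q * (1 + a)) = (fun_act K f x powr s)\<^sup>2"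
      by (simp add: s_def power2_eq_square flip: powr_add)
    also have "\<dots> \<le> (fun_act K u x)\<^sup>2" using le by (intro power_mono) auto
    finally show "(fun_act K f x) powr (q * (1 + a)) * \<mu> x \<le> (fun_act K u x)\<^sup>2 * \<mu> x"
      using mu0 by (rule mult_right_mono)
  qed
  also have "\<dots> \<le> (\<Sum>\<^sub>\<infinity>x. (fun_act K u x)\<^sup>2 * \<mu> x)"
    using fun_act_in_lp2[OF A(1) uA] mu0 B by (intro finite_sum_le_infsum) (auto simp: lp2_iff)
  also have "\<dots> \<le> (\<Sum>x\<in>A. u x powr (2 / (1 + a)) * \<mu> x) powr (1 + a)"
    by (rule contraction_below_two[OF LS A(1) uA u0])
  also have "\<dots> = (\<Sum>x\<in>A. f x powr q * \<mu> x) powr (1 + a)"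
    using a0 by (simp add: u_def powr_powr s_def)
  finally show ?thesis .
qed

lemma hypercontractive_nonneg:
  assumes LS: "log_sobolev_bound (kernel_comp (l2_adjoint \<mu> K) K) \<mu> a"
    and f0: "\<And>x. f x \<ge> 0" and q1: "q \<ge> 1" and q: "q * (1 + a) \<ge> 2" and f: "f \<in> lp q \<mu>"
    and B: "finite B"
  shows "(\<Sum>x\<in>B. (fun_act K f x) powr (q * (1 + a)) * \<mu> x) \<le> (\<Sum>\<^sub>\<infinity>x. f x powr q * \<mu> x) powr (1 + a)"
proof -
  have a0: "a \<ge> 0" using LS by (simp add: log_sobolev_bound_def)
  have fs: "(\<lambda>x. f x powr q * \<mu> x) summable_on UNIV" using f f0 by (simp add: lp_def)
  define g where "g A x = (\<Sum>y\<in>A. K x y * f y)" for A x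
  have lim: "((\<lambda>A. g A x) \<longlongrightarrow> fun_act K f x) (finite_subsets_at_top UNIV)" for x
    unfolding fun_act_def g_def
    using infsum_tendsto[OF kernel_summable[OF q1 f, of x]] f0 by simp
  have g0: "g A x \<ge> 0" for A x unfolding g_def using K0 f0 by (intro sum_nonneg) simp
  have "((\<lambda>A. \<Sum>x\<in>B. g A x powr (q * (1 + a)) * \<mu> x) \<longlongrightarrow>
         (\<Sum>x\<in>B. (fun_act K f x) powr (q * (1 + a)) * \<mu> x)) (finite_subsets_at_top UNIV)"
    using q g0 by (intro tendsto_sum tendsto_mult tendsto_const tendsto_powr2 lim) auto
  then show ?thesis
  proof (rule tendsto_upperbound)
    show "\<forall>\<^sub>F A in finite_subsets_at_top UNIV.
            (\<Sum>x\<in>B. g A x powr (q * (1 + a)) * \<mu> x) \<le> (\<Sum>\<^sub>\<infinity>x. f x powr q * \<mu> x) powr (1 + a)"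
    proof (rule eventually_finite_subsets_at_top_weakI)
      fix A :: "'v set" assume A: "finite A"
      define h where "h x = (if x \<in> A then f x else 0)" for x
      have hA: "{x. h x \<noteq> 0} \<subseteq> A" by (auto simp: h_def)
      have h0: "h x \<ge> 0" for x using f0 by (simp add: h_def)
      have gh: "g A x = fun_act K h x" for x
        unfolding fun_act_finite[OF A hA] g_def by (intro sum.cong) (auto simp: h_def)
      have "(\<Sum>x\<in>B. g A x powr (q * (1 + a)) * \<mu> x) \<le> (\<Sum>x\<in>A. h x powr q * \<mu> x) powr (1 + a)"
        unfolding gh by (rule hypercontractive_finite_support[OF LS A hA h0 q B])
      also have "(\<Sum>x\<in>A. h x powr q * \<mu> x) = (\<Sum>x\<in>A. f x powr q * \<mu> x)"
        by (intro sum.cong) (auto simp: h_def)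
      also have "\<dots> powr (1 + a) \<le> (\<Sum>\<^sub>\<infinity>x. f x powr q * \<mu> x) powr (1 + a)"
        using a0 mu0 A by (intro powr_mono2 finite_sum_le_infsum fs sum_nonneg) auto
      finally show "(\<Sum>x\<in>B. g A x powr (q * (1 + a)) * \<mu> x) \<le> \<dots>" .
    qed
  qed simp
qed

lemma abs_fun_act_le:
  assumes q: "q \<ge> 1" and f: "f \<in> lp q \<mu>"
  shows "\<bar>fun_act K f x\<bar> \<le> fun_act K (\<lambda>y. \<bar>f y\<bar>) x"
proof -
  have "(\<lambda>y. norm (K x y * f y)) summable_on UNIV"
    using kernel_summable[OF assms, of x] K0 by (simp add: abs_mult)
  from norm_infsum_bound[OF this] show ?thesis
    using K0 by (simp add: fun_act_def abs_mult)
qed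

theorem hypercontractive:
  assumes LS: "log_sobolev_bound (kernel_comp (l2_adjoint \<mu> K) K) \<mu> a"
    and q1: "q \<ge> 1" and q: "q * (1 + a) \<ge> 2" and f: "f \<in> lp q \<mu>"
  shows "fun_act K f \<in> lp (q * (1 + a)) \<mu>"
    and "lp_norm (q * (1 + a)) \<mu> (fun_act K f) \<le> lp_norm q \<mu> f"
proof -
  have a0: "a \<ge> 0" using LS by (simp add: log_sobolev_bound_def)
  have fa: "(\<lambda>x. \<bar>f x\<bar>) \<in> lp q \<mu>" using f by (simp add: lp_def)
  let ?C = "(\<Sum>\<^sub>\<infinity>x. \<bar>f x\<bar> powr q * \<mu> x) powr (1 + a)"
  have bound: "(\<Sum>x\<in>B. \<bar>fun_act K f x\<bar> powr (q * (1 + a)) * \<mu> x) \<le> ?C" if B: "finite B" for B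
  proof -
    have "(\<Sum>x\<in>B. \<bar>fun_act K f x\<bar> powr (q * (1 + a)) * \<mu> x)
        \<le> (\<Sum>x\<in>B. (fun_act K (\<lambda>y. \<bar>f y\<bar>) x) powr (q * (1 + a)) * \<mu> x)"
      using mu0 q abs_fun_act_le[OF q1 f] by (intro sum_mono mult_right_mono powr_mono2) auto
    also have "\<dots> \<le> ?C" by (rule hypercontractive_nonneg[OF LS _ q1 q fa B]) simp
    finally show ?thesis .
  qed
  show mem: "fun_act K f \<in> lp (q * (1 + a)) \<mu>"
    unfolding lp_def mem_Collect_eq
    by (rule nonneg_bdd_above_summable_on) (use mu0 bound in \<open>auto intro!: bdd_aboveI2\<close>)
  have "(\<Sum>\<^sub>\<infinity>x. \<bar>fun_act K f x\<bar> powr (q * (1 + a)) * \<mu> x) \<le> ?C"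
    by (rule infsum_le_finite_sums) (use mem bound in \<open>auto simp: lp_def\<close>)
  then have "lp_norm (q * (1 + a)) \<mu> (fun_act K f) \<le> ?C powr (1 / (q * (1 + a)))"
    unfolding lp_norm_def using q mu0 by (intro powr_mono2 infsum_nonneg) auto
  also have "\<dots> = lp_norm q \<mu> f"
    using a0 q1 by (simp add: lp_norm_def powr_powr)
  finally show "lp_norm (q * (1 + a)) \<mu> (fun_act K f) \<le> lp_norm q \<mu> f" .
qed

end

section \<open>Changing the reference measure\<close>

lemma mass_pos:
  assumes pos: "\<And>x. \<mu> x > (0::real)" and s: "\<mu> summable_on UNIV"
  shows "mass \<mu> > 0"
proof -
  fix x
  have "(\<Sum>x\<in>{x}. \<mu> x) \<le> mass \<mu>"
    unfolding mass_def using pos s by (intro finite_sum_le_infsum) (auto simp: less_imp_le)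
  then show ?thesis using pos[of x] by simp
qed

lemma lp_normalized:
  assumes pos: "\<And>x. \<mu> x > (0::real)" and s: "\<mu> summable_on UNIV"
  shows "lp q (normalized \<mu>) = lp q \<mu>"
proof -
  have "(\<lambda>x. \<bar>f x\<bar> powr q * normalized \<mu> x) summable_on UNIV \<longleftrightarrow> (\<lambda>x. \<bar>f x\<bar> powr q * \<mu> x) summable_on UNIV"
    for f :: "'a \<Rightarrow> real"
    using summable_on_cmult_left'[of "1 / mass \<mu>" "\<lambda>x. \<bar>f x\<bar> powr q * \<mu> x" UNIV] mass_pos[OF assms]
    by (simp add: normalized_def)
  then show ?thesis by (simp add: lp_def)
qed

lemma lp_norm_normalized_mono:
  assumes pos: "\<And>x. \<mu> x > (0::real)" and le: "\<And>x. \<mu> x \<le> \<nu> x" and s: "\<nu> summable_on UNIV"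
    and p: "p > 0" and f: "f \<in> lp p \<nu>"
  shows "f \<in> lp p \<mu>"
    and "lp_norm p (normalized \<mu>) f \<le> lp_norm p (normalized \<nu>) f * (mass \<nu> / mass \<mu>) powr (1 / p)"
proof -
  have mu0: "0 \<le> \<mu> x" for x using pos[of x] by simp
  have pos': "\<nu> x > 0" for x using pos le by (rule less_le_trans)
  have s': "\<mu> summable_on UNIV"
    by (rule summable_on_comparison_test[OF s]) (use le mu0 in auto)
  note m = mass_pos[OF pos s'] and n = mass_pos[OF pos' s]
  have sf: "(\<lambda>x. \<bar>f x\<bar> powr p * \<nu> x) summable_on UNIV" using f by (simp add: lp_def)
  have sf': "(\<lambda>x. \<bar>f x\<bar> powr p * \<mu> x) summable_on UNIV"
    by (rule summable_on_comparison_test[OF sf]) (use le mu0 in \<open>auto intro: mult_left_mono\<close>)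
  then show "f \<in> lp p \<mu>" by (simp add: lp_def)
  have nrm: "(\<Sum>\<^sub>\<infinity>x. \<bar>f x\<bar> powr p * normalized \<rho> x) = (\<Sum>\<^sub>\<infinity>x. \<bar>f x\<bar> powr p * \<rho> x) / mass \<rho>" for \<rho>
    using infsum_cmult_left'[of "\<lambda>x. \<bar>f x\<bar> powr p * \<rho> x" "1 / mass \<rho>" UNIV]
    by (simp add: normalized_def)
  have le2: "(\<Sum>\<^sub>\<infinity>x. \<bar>f x\<bar> powr p * \<mu> x) \<le> (\<Sum>\<^sub>\<infinity>x. \<bar>f x\<bar> powr p * \<nu> x)"
    using le by (intro infsum_mono sf sf' mult_left_mono) auto
  have nn: "0 \<le> (\<Sum>\<^sub>\<infinity>x. \<bar>f x\<bar> powr p * \<mu> x)" using mu0 by (intro infsum_nonneg) simp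
  have "(\<Sum>\<^sub>\<infinity>x. \<bar>f x\<bar> powr p * normalized \<mu> x)
      \<le> (\<Sum>\<^sub>\<infinity>x. \<bar>f x\<bar> powr p * normalized \<nu> x) * (mass \<nu> / mass \<mu>)"
    unfolding nrm using le2 m n by (simp add: divide_right_mono)
  then have "lp_norm p (normalized \<mu>) f
      \<le> ((\<Sum>\<^sub>\<infinity>x. \<bar>f x\<bar> powr p * normalized \<nu> x) * (mass \<nu> / mass \<mu>)) powr (1 / p)"
    unfolding lp_norm_def using p nn m by (intro powr_mono2) (auto simp: nrm)
  also have "\<dots> = lp_norm p (normalized \<nu>) f * (mass \<nu> / mass \<mu>) powr (1 / p)"
    unfolding lp_norm_def by (rule powr_mult)
  finally show "lp_norm p (normalized \<mu>) f \<le> \<dots>" .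
qed

lemma invariant_probability_normalized:
  assumes K: "markov_kernel K" and pos: "\<And>x. \<mu> x > 0" and inv: "measure_act \<mu> K = \<mu>"
    and s: "\<mu> summable_on UNIV"
  shows "invariant_probability (normalized \<mu>) K"
proof
  note m = mass_pos[OF pos s]
  have eq: "normalized \<mu> x = \<mu> x * (1 / mass \<mu>)" for x by (simp add: normalized_def)
  show "markov_kernel K" by (rule K)
  show "normalized \<mu> x > 0" for x using pos m by (simp add: eq)
  show "(normalized \<mu> has_sum 1) UNIV"
    using has_sum_cmult_left[OF has_sum_infsum[OF s], where c = "1 / mass \<mu>"] m
    unfolding eq[abs_def] by (simp add: mass_def)
  show "measure_act (normalized \<mu>) K = normalized \<mu>"
  proof
    fix y
    have "((\<lambda>x. normalized \<mu> x * K x y) has_sum normalized \<mu> y) UNIV"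
      using has_sum_cmult_left[OF measure_act_has_sum[OF pos inv, of y], where c = "1 / mass \<mu>"]
      by (simp add: eq mult_ac)
    then show "measure_act (normalized \<mu>) K y = normalized \<mu> y"
      unfolding measure_act_def by (rule infsumI)
  qed
qed

section \<open>Products of kernels\<close>

lemma kernel_comp_id_left: "kernel_comp kernel_id K = K"
proof (intro ext)
  fix x z
  show "kernel_comp kernel_id K x z = K x z"
    unfolding kernel_comp_def by (subst infsum_delta[of x]) (auto simp: kernel_id_def)
qed

lemma markov_kernel_id: "markov_kernel kernel_id"
proof -
  have "(kernel_id x has_sum 1) UNIV" for x :: 'a
    using has_sum_finite_support[of "{x}" "kernel_id x"] by (simp add: kernel_id_def)
  then show ?thesis by (simp add: markov_kernel_def kernel_id_def)
qed

lemma markov_kernel_prod: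
  assumes "\<And>s. s \<ge> 1 \<Longrightarrow> markov_kernel (K s)"
  shows "markov_kernel (kernel_prod K t)"
  by (induction t) (use assms in \<open>auto intro: markov_kernel_id markov_kernel_comp\<close>)

lemma fun_act_kernel_comp:
  assumes P: "markov_kernel P" and K: "markov_kernel K"
    and sK: "\<And>y. (\<lambda>z. K y z * \<bar>f z\<bar>) summable_on UNIV"
    and sP: "(\<lambda>y. P x y * fun_act K (\<lambda>z. \<bar>f z\<bar>) y) summable_on UNIV"
  shows "(\<lambda>z. kernel_comp P K x z * f z) summable_on UNIV"
    and "fun_act (kernel_comp P K) f x = fun_act P (fun_act K f) x"
proof -
  have P0: "0 \<le> P x y" for y using P by (simp add: markov_kernel_def)
  have K0: "0 \<le> K y z" for y z using K by (simp add: markov_kernel_def)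
  have "(\<lambda>(y,z). P x y * (K y z * \<bar>f z\<bar>)) summable_on (UNIV \<times> UNIV)"
  proof (rule summable_on_SigmaI)
    show "(\<lambda>y. P x y * fun_act K (\<lambda>z. \<bar>f z\<bar>) y) summable_on UNIV" by (rule sP)
    show "((\<lambda>z. case (y, z) of (y, z) \<Rightarrow> P x y * (K y z * \<bar>f z\<bar>)) has_sum
            (P x y * fun_act K (\<lambda>z. \<bar>f z\<bar>) y)) UNIV" for y
      unfolding fun_act_def using has_sum_cmult_right[OF has_sum_infsum[OF sK[of y]]] by simp
  qed (use P0 K0 in auto)
  then have "(\<lambda>w. norm (case w of (y,z) \<Rightarrow> P x y * (K y z * f z))) summable_on (UNIV \<times> UNIV)"
    using P0 K0 by (simp add: abs_mult case_prod_unfold)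
  then have s: "(\<lambda>(y,z). P x y * (K y z * f z)) summable_on (UNIV \<times> UNIV)"
    by (rule abs_summable_summable)
  have inner: "(\<Sum>\<^sub>\<infinity>y. P x y * (K y z * f z)) = kernel_comp P K x z * f z" for z
    unfolding kernel_comp_def by (simp add: mult.assoc flip: infsum_cmult_left')
  have "(\<lambda>(z,y). P x y * (K y z * f z)) summable_on (UNIV \<times> UNIV)"
    using s by (subst summable_on_swap) (simp add: case_prod_unfold)
  then have "(\<lambda>z. \<Sum>\<^sub>\<infinity>y. P x y * (K y z * f z)) summable_on UNIV"
    using summable_on_Sigma_banach[of "\<lambda>z y. P x y * (K y z * f z)" UNIV "\<lambda>_. UNIV"] by simp
  then show "(\<lambda>z. kernel_comp P K x z * f z) summable_on UNIV" by (simp add: inner)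
  have "fun_act P (fun_act K f) x = (\<Sum>\<^sub>\<infinity>y. \<Sum>\<^sub>\<infinity>z. P x y * (K y z * f z))"
    by (simp add: fun_act_def infsum_cmult_right')
  also have "\<dots> = (\<Sum>\<^sub>\<infinity>z. \<Sum>\<^sub>\<infinity>y. P x y * (K y z * f z))"
    by (rule infsum_swap_banach[OF s])
  finally show "fun_act (kernel_comp P K) f x = fun_act P (fun_act K f) x"
    by (simp add: inner fun_act_def)
qed

theorem theorem3p16:
  fixes K :: "nat \<Rightarrow> 'v::countable \<Rightarrow> 'v \<Rightarrow> real"
    and \<pi> :: "nat \<Rightarrow> 'v \<Rightarrow> real"
    and q p :: real and t :: nat and f :: "'v \<Rightarrow> real"
  assumes two_points: "\<exists>x y :: 'v. x \<noteq> y"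
    and env: "finite_nondecreasing_env K \<pi>"
    and irreducible: "\<And>s. s \<ge> 1 \<Longrightarrow> irreducible_kernel (K s)"
    and aperiodic: "\<And>s. s \<ge> 1 \<Longrightarrow> aperiodic_kernel (K s)"
    and q: "q \<ge> 2"
    and t: "t \<ge> 1"
    and p: "1 \<le> p" "p \<le> q * (\<Prod>s=1..t. 1 + env_log_sobolev K \<pi> s)"
    and f: "f \<in> lp q (\<pi> t)"
  shows "(\<forall>x. (\<lambda>y. kernel_prod K t x y * f y) summable_on UNIV) \<and>
         fun_act (kernel_prod K t) f \<in> lp p (normalized (\<pi> 1)) \<and>
         lp_norm p (normalized (\<pi> 1)) (fun_act (kernel_prod K t) f)
           \<le> lp_norm q (normalized (\<pi> t)) f * (mass (\<pi> t) / mass (\<pi> 1)) powr (1 / q)"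
proof -
  let ?a = "env_log_sobolev K \<pi>"
  have mk: "markov_kernel (K s)" and pos: "\<pi> s x > 0" and inv: "measure_act (\<pi> s) (K s) = \<pi> s"
    and sm: "\<pi> s summable_on UNIV" and mono: "\<pi> s x \<le> \<pi> (Suc s) x" if "s \<ge> 1" for s x
    using env that by (auto simp: finite_nondecreasing_env_def)
  have ip: "invariant_probability (normalized (\<pi> s)) (K s)" if "s \<ge> 1" for s
    by (intro invariant_probability_normalized mk pos inv sm that)
  have LS: "log_sobolev_bound (kernel_comp (l2_adjoint (normalized (\<pi> s)) (K s)) (K s))
              (normalized (\<pi> s)) (?a s)" if "s \<ge> 1" for s
    by (rule env_log_sobolev_greatest(1)[OF env that two_points])
  have a0: "?a s \<ge> 0" if "s \<ge> 1" for s
    using LS[OF that] by (simp add: log_sobolev_bound_def)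
  have ge2: "q * (1 + ?a s) \<ge> 2" if "s \<ge> 1" "q \<ge> 2" for s q
  proof -
    have "0 \<le> q * ?a s" using a0 that by simp
    then show ?thesis using that by (simp add: distrib_left)
  qed
  have step: "fun_act (K s) f \<in> lp (q * (1 + ?a s)) (normalized (\<pi> s))"
    "lp_norm (q * (1 + ?a s)) (normalized (\<pi> s)) (fun_act (K s) f) \<le> lp_norm q (normalized (\<pi> s)) f"
    "\<And>x. (\<lambda>y. K s x y * \<bar>f y\<bar>) summable_on UNIV"
    if s: "s \<ge> 1" and q: "q \<ge> 2" and f: "f \<in> lp q (\<pi> s)" for s q f
  proof -
    interpret M: invariant_probability "normalized (\<pi> s)" "K s" by (rule ip[OF s])
    have f': "f \<in> lp q (normalized (\<pi> s))"
      using f lp_normalized[of "\<pi> s"] pos sm s by blast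
    show "fun_act (K s) f \<in> lp (q * (1 + ?a s)) (normalized (\<pi> s))"
      "lp_norm (q * (1 + ?a s)) (normalized (\<pi> s)) (fun_act (K s) f) \<le> lp_norm q (normalized (\<pi> s)) f"
      using M.hypercontractive[OF LS[OF s] _ ge2[OF s q] f'] q by auto
    show "\<And>x. (\<lambda>y. K s x y * \<bar>f y\<bar>) summable_on UNIV"
      using M.kernel_summable[OF _ f'] q by auto
  qed
  show ?thesis
    using t q p f
  proof (induction t arbitrary: q f rule: nat_induct_at_least)
    case base
    interpret M: invariant_probability "normalized (\<pi> 1)" "K 1" by (rule ip) simp
    have k: "kernel_prod K 1 = K 1" by (simp add: kernel_comp_id_left)
    have "(\<lambda>y. norm (K 1 x y * f y)) summable_on UNIV" for x
      using step(3)[OF _ base(1) base(4), of x] M.K0 by (simp add: abs_mult)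
    then have "(\<lambda>y. K 1 x y * f y) summable_on UNIV" for x by (rule abs_summable_summable)
    moreover have "p \<le> q * (1 + ?a 1)" using base(3) by simp
    ultimately show ?case
      unfolding k
      using M.lp_antimono[OF base(2) _ step(1)[OF _ base(1) base(4)]] step(2)[OF _ base(1) base(4)]
        mass_pos[of "\<pi> 1"] pos[of 1] sm[of 1]
      by force
  next
    case (Suc t)
    let ?r = "q * (1 + ?a (Suc t))"
    let ?g = "fun_act (K (Suc t)) f"
    let ?P = "kernel_prod K t"
    have t1: "t \<ge> 1" by (rule Suc.hyps)
    have r2: "?r \<ge> 2" using ge2 Suc.prems by simp
    have qr: "q \<le> ?r" using a0[of "Suc t"] Suc.prems by simp
    have pr: "p \<le> ?r * (\<Prod>s=1..t. 1 + ?a s)" using Suc.prems by (simp add: mult_ac)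
    have lpS: "lp e (normalized (\<pi> (Suc t))) = lp e (\<pi> (Suc t))" for e
      using lp_normalized[of "\<pi> (Suc t)"] pos sm by simp
    have down: "h \<in> lp ?r (\<pi> t)"
      "lp_norm ?r (normalized (\<pi> t)) h \<le>
         lp_norm ?r (normalized (\<pi> (Suc t))) h * (mass (\<pi> (Suc t)) / mass (\<pi> t)) powr (1 / ?r)"
      if "h \<in> lp ?r (normalized (\<pi> (Suc t)))" for h
      using lp_norm_normalized_mono[of "\<pi> t" "\<pi> (Suc t)" ?r h] pos mono sm t1 that r2
      by (auto simp: lpS)
    have fabs: "(\<lambda>x. \<bar>f x\<bar>) \<in> lp q (\<pi> (Suc t))" using Suc.prems(4) by (simp add: lp_def)
    note st = step[OF _ Suc.prems(1) Suc.prems(4), simplified]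
    have "fun_act (K (Suc t)) (\<lambda>x. \<bar>f x\<bar>) \<in> lp ?r (\<pi> t)"
      using step(1)[OF _ Suc.prems(1) fabs] by (intro down) simp
    from Suc.IH[OF r2 Suc.prems(2) pr this]
    have sP: "(\<lambda>y. ?P x y * fun_act (K (Suc t)) (\<lambda>x. \<bar>f x\<bar>) y) summable_on UNIV" for x
      by blast
    have mP: "markov_kernel ?P" by (rule markov_kernel_prod) (rule mk)
    note comp = fun_act_kernel_comp[OF mP mk[of "Suc t"] st(3) sP, simplified]
    have comp': "fun_act (kernel_prod K (Suc t)) f = fun_act ?P ?g"
      using comp(2) by (simp add: fun_eq_iff)
    note IH = Suc.IH[OF r2 Suc.prems(2) pr down(1)[OF st(1)]]
    have m: "mass (\<pi> s) > 0" if "s \<ge> 1" for s by (intro mass_pos pos sm that)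
    have mass_mono: "mass (\<pi> 1) \<le> mass (\<pi> (Suc t))"
    proof -
      have "\<pi> 1 x \<le> \<pi> (Suc t) x" for x
        by (rule lift_Suc_mono_le_ivl[of "{1..}" "\<lambda>s. \<pi> s x"]) (use mono in auto)
      then show ?thesis unfolding mass_def by (intro infsum_mono sm) auto
    qed
    have nf0: "0 \<le> lp_norm q (normalized (\<pi> (Suc t))) f" by (simp add: lp_norm_def)
    have "lp_norm p (normalized (\<pi> 1)) (fun_act ?P ?g)
        \<le> lp_norm ?r (normalized (\<pi> t)) ?g * (mass (\<pi> t) / mass (\<pi> 1)) powr (1 / ?r)"
      using IH by blast
    also have "\<dots> \<le> (lp_norm q (normalized (\<pi> (Suc t))) f * (mass (\<pi> (Suc t)) / mass (\<pi> t)) powr (1 / ?r))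
                   * (mass (\<pi> t) / mass (\<pi> 1)) powr (1 / ?r)"
      by (intro mult_right_mono order_trans[OF down(2)[OF st(1)]] st(2)) auto
    also have "\<dots> = lp_norm q (normalized (\<pi> (Suc t))) f * (mass (\<pi> (Suc t)) / mass (\<pi> 1)) powr (1 / ?r)"
      using m[of 1] m[of t] m[of "Suc t"] t1 by (simp add: mult.assoc flip: powr_mult)
    also have "\<dots> \<le> lp_norm q (normalized (\<pi> (Suc t))) f * (mass (\<pi> (Suc t)) / mass (\<pi> 1)) powr (1 / q)"
      using mass_mono m[of 1] qr Suc.prems(1) nf0
      by (intro mult_left_mono powr_mono frac_le) auto
    finally show ?case
      using IH comp(1) unfolding comp' by simp
  qed
qed

end
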